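(* Let $F:\mathbb{N}\to\mathbb{C}$ be such that all Wintner coefficients $\mathrm{Win}_qF$ exist ($q\in\mathbb{N}$) and all $P$-smooth Wintner coefficients $\mathrm{Win}^{(P)}_qF$ exist ($P$ prime, $q\in\mathbb{N}$). Assume Wintner's Smooth Assumption: there is a prime $P_F$ such that for every prime $P>P_F$ the series $\sum_{d\notin(P)}|F'(d)|/d$ converges, and $\lim_P\sum_{d\notin(P)}|F'(d)|/d=0$. Then: ( * ) $\lim_P \mathrm{Win}^{(P)}_qF=\mathrm{Win}_qF$ uniformly in $q\in\mathbb{N}$; ( ** ) for every $d\in\mathbb{N}$, $\lim_P \mathrm{Irr}^{(P)}_dF=0$; ( *** ) for every $a\in\mathbb{N}$, $F(a)=\lim_P\sum_{q\in(P)}(\mathrm{Win}_qF)c_q(a)$.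
   Context: $F'=F*\mu$ (Eratosthenes transform). For $V\in\mathbb{N}$, $(V)$ is the set of $n\in\mathbb{N}$ with no prime factor $>V$, and $)V($ the set of $n\in\mathbb{N}$ with no prime factor $\le V$. $\mathrm{Win}_qF=\sum_{d\equiv 0\bmod q}F'(d)/d$ and $\mathrm{Win}^{(P)}_qF=\sum_{d\in(P),\,d\equiv0\bmod q}F'(d)/d$ (convergent series). The irregular series is $\mathrm{Irr}^{(P)}_dF=\sum_{r\in)P(,\,r>1}F'(dr)/r:=\lim_{x\to\infty}\sum_{r\in)P(,\,1<r\le x}F'(dr)/r$. $c_q(a)$ is the Ramanujan sum; $\lim_P$ is the limit as $P\to\infty$ through primes. *)

theory Defs
  imports "HOL-Analysis.Analysis" "HOL-Computational_Algebra.Squarefree"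
begin

text \<open>
  Arithmetic functions have type \<^typ>\<open>nat \<Rightarrow> complex\<close>; their arguments are the positive integers and
  the value at \<open>0\<close> is never used.
\<close>

definition moebius :: "nat \<Rightarrow> int" where
  "moebius n = (if squarefree n then (-1) ^ card (prime_factors n) else 0)"

definition dirichlet_conv :: "(nat \<Rightarrow> complex) \<Rightarrow> (nat \<Rightarrow> complex) \<Rightarrow> nat \<Rightarrow> complex" where
  "dirichlet_conv f g n = (\<Sum>d | d dvd n. f d * g (n div d))"

definition eratosthenes :: "(nat \<Rightarrow> complex) \<Rightarrow> nat \<Rightarrow> complex" where
  "eratosthenes F = dirichlet_conv F (\<lambda>n. of_int (moebius n))"

definition smooth :: "nat \<Rightarrow> nat set" where
  "smooth V = {n. n > 0 \<and> (\<forall>p. prime p \<and> p dvd n \<longrightarrow> p \<le> V)}"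

definition sifted :: "nat \<Rightarrow> nat set" where
  "sifted V = {n. n > 0 \<and> (\<forall>p. prime p \<and> p dvd n \<longrightarrow> p > V)}"

definition multiples :: "nat \<Rightarrow> nat set" where
  "multiples q = {d. d > 0 \<and> q dvd d}"

text \<open>
  Series over a set \<open>A\<close> of positive integers are possibly only conditionally convergent, with the terms
  taken in increasing order. Filling the gaps with \<open>0\<close> makes them ordinary series.
\<close>

definition restrict_to :: "nat set \<Rightarrow> (nat \<Rightarrow> 'a::zero) \<Rightarrow> nat \<Rightarrow> 'a" where
  "restrict_to A f n = (if n \<in> A then f n else 0)"

definition Win_terms :: "(nat \<Rightarrow> complex) \<Rightarrow> nat \<Rightarrow> nat \<Rightarrow> complex" where
  "Win_terms F q = restrict_to (multiples q) (\<lambda>d. eratosthenes F d / of_nat d)"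

definition Win :: "(nat \<Rightarrow> complex) \<Rightarrow> nat \<Rightarrow> complex" where
  "Win F q = suminf (Win_terms F q)"

definition smooth_Win_terms :: "(nat \<Rightarrow> complex) \<Rightarrow> nat \<Rightarrow> nat \<Rightarrow> nat \<Rightarrow> complex" where
  "smooth_Win_terms F P q =
     restrict_to (smooth P \<inter> multiples q) (\<lambda>d. eratosthenes F d / of_nat d)"

definition smooth_Win :: "(nat \<Rightarrow> complex) \<Rightarrow> nat \<Rightarrow> nat \<Rightarrow> complex" where
  "smooth_Win F P q = suminf (smooth_Win_terms F P q)"

definition Irr_terms :: "(nat \<Rightarrow> complex) \<Rightarrow> nat \<Rightarrow> nat \<Rightarrow> nat \<Rightarrow> complex" where
  "Irr_terms F P d =
     restrict_to {r \<in> sifted P. r > 1} (\<lambda>r. eratosthenes F (d * r) / of_nat r)"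

definition Irr :: "(nat \<Rightarrow> complex) \<Rightarrow> nat \<Rightarrow> nat \<Rightarrow> complex" where
  "Irr F P d = suminf (Irr_terms F P d)"

definition ramanujan_sum :: "nat \<Rightarrow> nat \<Rightarrow> complex" where
  "ramanujan_sum q a =
     (\<Sum>j | j \<in> {1..q} \<and> coprime j q. cis (2 * pi * real j * real a / real q))"

definition Ramanujan_terms :: "(nat \<Rightarrow> complex) \<Rightarrow> nat \<Rightarrow> nat \<Rightarrow> nat \<Rightarrow> complex" where
  "Ramanujan_terms F P a = restrict_to (smooth P) (\<lambda>q. Win F q * ramanujan_sum q a)"

text \<open>The filter of \<open>P \<rightarrow> \<infinity>\<close> through the primes.\<close>

definition primes_at_top :: "nat filter" where
  "primes_at_top = inf at_top (principal {p. prime p})"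

lemma eventually_primes_at_top:
  "eventually Q primes_at_top \<longleftrightarrow> (\<exists>N. \<forall>p\<ge>N. prime p \<longrightarrow> Q p)"
  by (simp add: primes_at_top_def eventually_inf_principal eventually_at_top_linorder)

lemma primes_at_top_neq_bot: "primes_at_top \<noteq> bot"
  by (metis bigger_prime eventually_False eventually_primes_at_top less_imp_le)

definition nonsmooth_tail_terms :: "(nat \<Rightarrow> complex) \<Rightarrow> nat \<Rightarrow> nat \<Rightarrow> real" where
  "nonsmooth_tail_terms F P =
     restrict_to {d. d > 0 \<and> d \<notin> smooth P} (\<lambda>d. cmod (eratosthenes F d) / real d)"

definition Wintner_Smooth_Assumption :: "(nat \<Rightarrow> complex) \<Rightarrow> bool" where
  "Wintner_Smooth_Assumption F \<longleftrightarrow>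
     (\<exists>P\<^sub>F. prime P\<^sub>F \<and> (\<forall>P. prime P \<and> P > P\<^sub>F \<longrightarrow> summable (nonsmooth_tail_terms F P))) \<and>
     ((\<lambda>P. suminf (nonsmooth_tail_terms F P)) \<longlongrightarrow> 0) primes_at_top"

end

theory Submission
  imports Defs
begin

text \<open>
  All three errors are dominated by the tail \<open>\<Sum> \<bar>F' n\<bar> / n\<close> over the \<open>n\<close> that are not \<open>P\<close>-smooth, with
  constants \<open>1\<close>, \<open>d\<close> and \<open>a\<close> respectively. For the third one, the map \<open>q \<mapsto> c\<^sub>q(a)\<close> is the Eratosthenes
  transform of \<open>m \<mapsto> m [m dvd a]\<close>; hence it vanishes at all but finitely many \<open>P\<close>-smooth \<open>q\<close>, and
  Moebius inversion evaluates its sums over divisors.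
\<close>

section \<open>Moebius inversion\<close>

lemma moebius_prime_mult:
  assumes "prime p" "e > 0" "\<not> p dvd e"
  shows "moebius (p * e) = - moebius e"
proof -
  have cop: "coprime p e" using assms by (simp add: prime_imp_coprime)
  have "squarefree (p * e) \<longleftrightarrow> squarefree e"
    using cop assms(1) squarefree_multD(2) squarefree_mult_coprime squarefree_prime by blast
  moreover have "card (prime_factors (p * e)) = Suc (card (prime_factors e))"
  proof -
    have "prime_factors (p * e) = insert p (prime_factors e)"
      using assms by (simp add: prime_factors_product prime_factorization_prime prime_gt_0_nat)
    moreover have "p \<notin> prime_factors e" using assms by auto
    ultimately show ?thesis by simp
  qed
  ultimately show ?thesis by (simp add: moebius_def)
qed

text \<open>For a prime \<open>p\<close> dividing \<open>n\<close>, each divisor \<open>d\<close>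
  not divisible by \<open>p\<close> cancels against \<open>p * d\<close>. The remaining divisors are
  multiples of the square of \<open>p\<close>, where \<open>moebius\<close> vanishes.\<close>

lemma sum_moebius_divisors:
  assumes "n > 0"
  shows "(\<Sum>d | d dvd n. moebius d) = (if n = 1 then 1 else 0)"
proof (cases "n = 1")
  case True
  have "{d. d dvd (1::nat)} = {1}" by auto
  then show ?thesis using True by (simp add: moebius_def)
next
  case False
  then obtain p where p: "prime p" "p dvd n" using prime_factor_nat by blast
  define A where "A = {d. d dvd n \<and> \<not> p dvd d}"
  have fin: "finite {d. d dvd n}" using assms by simp
  have finA: "finite A" unfolding A_def using fin by (rule rev_finite_subset) auto
  have inj: "inj_on ((*) p) A" using p(1) by (auto intro!: inj_onI simp: prime_gt_0_nat)
  have "(\<Sum>d | d dvd n. moebius d) = (\<Sum>d \<in> A \<union> (*) p ` A. moebius d)"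
  proof (rule sum.mono_neutral_right[OF fin])
    have "p * e dvd n" if "e dvd n" "\<not> p dvd e" for e
      using that p by (simp add: divides_mult prime_imp_coprime)
    then show "A \<union> (*) p ` A \<subseteq> {d. d dvd n}" by (auto simp: A_def)
    show "\<forall>d\<in>{d. d dvd n} - (A \<union> (*) p ` A). moebius d = 0"
    proof
      fix d assume d: "d \<in> {d. d dvd n} - (A \<union> (*) p ` A)"
      then have "p dvd d" by (auto simp: A_def)
      then obtain e where e: "d = p * e" by auto
      have "e dvd n" using d e dvd_mult_right by auto
      with d e have "p dvd e" by (auto simp: A_def)
      then have "p ^ 2 dvd d" using e by (auto simp: power2_eq_square)
      then have "\<not> squarefree d" using p(1) by (auto simp: squarefree_def)
      then show "moebius d = 0" by (simp add: moebius_def)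
    qed
  qed
  also have "\<dots> = (\<Sum>d\<in>A. moebius d) + (\<Sum>d\<in>(*) p ` A. moebius d)"
    by (rule sum.union_disjoint) (use finA in \<open>auto simp: A_def\<close>)
  also have "(\<Sum>d\<in>(*) p ` A. moebius d) = (\<Sum>d\<in>A. moebius (p * d))"
    using inj by (simp add: sum.reindex)
  also have "\<dots> = (\<Sum>d\<in>A. - moebius d)"
    by (intro sum.cong refl moebius_prime_mult p)
       (use dvd_pos_nat[OF assms] in \<open>auto simp: A_def\<close>)
  finally show ?thesis using False by (simp add: sum_negf)
qed

lemma sum_of_moebius_divisors:
  "n > 0 \<Longrightarrow> (\<Sum>d | d dvd n. of_int (moebius d)) = (if n = 1 then 1 else (0::complex))"
  using sum_moebius_divisors[of n] by (simp flip: of_int_sum)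

text \<open>Writing \<open>d = e * k\<close> and summing over \<open>k\<close> first leaves a
  Moebius sum over the divisors of \<open>n div e\<close>, which vanishes unless
  \<open>e = n\<close>.\<close>

lemma sum_eratosthenes_divisors:
  assumes "n > 0"
  shows "(\<Sum>d | d dvd n. eratosthenes F d) = F n"
proof -
  have fin: "finite {d. d dvd n}" using assms by simp
  have "(\<Sum>d | d dvd n. eratosthenes F d)
      = (\<Sum>(d, e)\<in>(SIGMA d:{d. d dvd n}. {e. e dvd d}). F e * of_int (moebius (d div e)))"
    unfolding eratosthenes_def dirichlet_conv_def
    using dvd_pos_nat[OF assms] by (subst sum.Sigma) (auto simp: fin)
  also have "\<dots> = (\<Sum>(e, k)\<in>(SIGMA e:{e. e dvd n}. {k. k dvd n div e}). F e * of_int (moebius k))"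
  proof (rule sum.reindex_bij_witness[where i = "\<lambda>(e, k). (e * k, e)"
        and j = "\<lambda>(d, e). (e, d div e)"], goal_cases)
    case (2 x)
    then show ?case using dvd_trans[of _ "fst x" n] by auto
  next
    case (3 x)
    then show ?case using assms by auto
  next
    case (4 x)
    then show ?case using dvd_pos_nat[OF assms] by (auto simp: dvd_div_iff_mult mult.commute)
  qed auto
  also have "\<dots> = (\<Sum>e | e dvd n. F e * (\<Sum>k | k dvd n div e. of_int (moebius k)))"
  proof -
    have "finite {k. k dvd n div e}" if "e dvd n" for e
      using that assms by (intro finite_divisors_nat) (auto simp: dvd_div_eq_0_iff simp flip: neq0_conv)
    then show ?thesis using fin by (simp add: sum.Sigma sum_distrib_left)
  qed
  also have "\<dots> = (\<Sum>e | e dvd n. if e = n then F e else 0)"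
  proof (rule sum.cong)
    fix e assume "e \<in> {e. e dvd n}"
    then obtain k where k: "n = e * k" by auto
    then have "e > 0" "k > 0" using assms by auto
    then show "F e * (\<Sum>k | k dvd n div e. of_int (moebius k)) = (if e = n then F e else 0)"
      using k by (simp add: sum_of_moebius_divisors)
  qed simp
  also have "\<dots> = F n" using fin by simp
  finally show ?thesis .
qed

section \<open>Ramanujan sums\<close>

text \<open>A geometric sum over the powers of an \<open>m\<close>-th root of unity
  \<open>w\<close>, where \<open>w = 1\<close> exactly when \<open>m\<close> divides
  \<open>a\<close>.\<close>

lemma sum_cis_multiples:
  assumes "m > 0"
  shows "(\<Sum>k\<in>{1..m}. cis (2 * pi * real k * real a / real m)) = (if m dvd a then of_nat m else 0)"
proof -
  define w where "w = cis (2 * pi * real a / real m)"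
  have pw: "cis (2 * pi * real k * real a / real m) = w ^ k" for k
    unfolding w_def Complex.DeMoivre by (rule arg_cong[where f = cis]) simp
  have wm: "w ^ m = 1"
    using assms by (simp add: w_def Complex.DeMoivre)
  \<comment> \<open>Starting the exponents at 0 costs a factor \<open>w\<close>, which is harmless:
    the sum is 0 unless \<open>w = 1\<close>.\<close>
  have "(\<Sum>k\<in>{1..m}. w ^ k) = (\<Sum>k<m. w ^ Suc k)"
    by (rule sum.reindex_bij_witness[where i = Suc and j = "\<lambda>k. k - 1"]) auto
  also have "\<dots> = w * (\<Sum>k<m. w ^ k)" by (simp add: sum_distrib_left)
  also have "\<dots> = (if m dvd a then of_nat m else 0)"
  proof (cases "m dvd a")
    case True
    then have "w = 1" using assms
      by (auto simp: w_def elim!: dvdE) (metis Ints_of_nat cis_multiple_2pi mult.assoc)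
    then show ?thesis using True by simp
  next
    case False
    have "w \<noteq> 1"
    proof
      assume "w = 1"
      then have "cos (2 * pi * real a / real m) = 1" by (simp add: w_def complex_eq_iff)
      then obtain z :: int where "2 * pi * real a / real m = of_int z * 2 * pi"
        by (auto simp: cos_one_2pi_int)
      then have "real a = of_int z * real m" using assms by (simp add: field_simps)
      then have "int a = z * int m" by (metis of_int_eq_iff of_int_mult of_int_of_nat_eq)
      then have "int m dvd int a" by simp
      then show False using False by simp
    qed
    then show ?thesis using False wm by (simp add: sum_gp_strict)
  qed
  finally show ?thesis by (simp add: pw)
qed

text \<open>A Moebius sum over the common divisors \<open>e\<close> of \<open>j\<close> and
  \<open>q\<close> detects coprimality. With \<open>j = e * k\<close> and \<open>q = e * m\<close>
  the fraction \<open>j / q\<close> becomes \<open>k / m\<close>, and \<open>k\<close> runs through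
  all of \<open>{1..m}\<close>, so the inner sum is a complete sum of powers of a root of
  unity.\<close>

lemma ramanujan_sum_eq_eratosthenes:
  assumes "q > 0"
  shows "ramanujan_sum q a = eratosthenes (\<lambda>m. if m dvd a then of_nat m else 0) q"
proof -
  let ?c = "\<lambda>j. cis (2 * pi * real j * real a / real q)"
  have "ramanujan_sum q a = (\<Sum>j\<in>{1..q}. if coprime j q then ?c j else 0)"
    unfolding ramanujan_sum_def by (subst sum.inter_filter[symmetric]) auto
  also have "\<dots> = (\<Sum>j\<in>{1..q}. \<Sum>e | e dvd q \<and> e dvd j. of_int (moebius e) * ?c j)"
  proof (rule sum.cong)
    fix j assume j: "j \<in> {1..q}"
    have "(\<Sum>e | e dvd q \<and> e dvd j. of_int (moebius e) * ?c j)
        = (\<Sum>e | e dvd gcd j q. of_int (moebius e)) * ?c j"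
      by (simp add: sum_distrib_right conj_commute)
    also have "\<dots> = (if coprime j q then ?c j else 0)"
      using j assms by (subst sum_of_moebius_divisors) (auto simp: coprime_iff_gcd_eq_1)
    finally show "(if coprime j q then ?c j else 0)
        = (\<Sum>e | e dvd q \<and> e dvd j. of_int (moebius e) * ?c j)" by simp
  qed simp
  also have "\<dots> = (\<Sum>(j, e)\<in>(SIGMA j:{1..q}. {e. e dvd q \<and> e dvd j}). of_int (moebius e) * ?c j)"
    using assms by (subst sum.Sigma) auto
  also have "\<dots> = (\<Sum>(m, k)\<in>(SIGMA m:{m. m dvd q}. {1..m}).
      of_int (moebius (q div m)) * cis (2 * pi * real k * real a / real m))"
  proof (rule sum.reindex_bij_witness[where i = "\<lambda>(m, k). (q div m * k, q div m)"
        and j = "\<lambda>(j, e). (q div e, j div e)"], goal_cases)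
    case (1 x)
    then obtain j e where x: "x = (j, e)" "e dvd q" "e dvd j" by auto
    then obtain m k where "q = e * m" "j = e * k" by (auto elim!: dvdE)
    then show ?case using x assms by simp
  next
    case (2 x)
    then obtain j e where x: "x = (j, e)" "e dvd q" "e dvd j" "1 \<le> j" "j \<le> q" by auto
    then obtain m k where "q = e * m" "j = e * k" by (auto elim!: dvdE)
    then show ?case using x assms by simp
  next
    case (3 x)
    then obtain m k where x: "x = (m, k)" "m dvd q" by auto
    then obtain e where "q = m * e" by (auto elim!: dvdE)
    then show ?case using x assms by simp
  next
    case (4 x)
    then obtain m k where x: "x = (m, k)" "m dvd q" "1 \<le> k" "k \<le> m" by auto
    then obtain e where "q = m * e" by (auto elim!: dvdE)
    then show ?case using x assms by simp
  next
    case (5 x)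
    then obtain j e where x: "x = (j, e)" "e dvd q" "e dvd j" by auto
    then obtain m k where "q = e * m" "j = e * k" by (auto elim!: dvdE)
    then show ?case using x assms by (simp add: mult.assoc)
  qed
  also have "\<dots> = (\<Sum>m | m dvd q. of_int (moebius (q div m))
      * (\<Sum>k\<in>{1..m}. cis (2 * pi * real k * real a / real m)))"
    using assms by (subst sum.Sigma[symmetric]) (auto simp: sum_distrib_left)
  also have "\<dots> = (\<Sum>m | m dvd q. of_int (moebius (q div m)) * (if m dvd a then of_nat m else 0))"
    by (intro sum.cong refl arg_cong2[where f = "(*)"] sum_cis_multiples)
       (use dvd_pos_nat[OF assms] in auto)
  finally show ?thesis
    by (simp add: eratosthenes_def dirichlet_conv_def mult.commute)
qed

text \<open>A nonzero term in the divisor formula for the Ramanujan sum gives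
  \<open>q = m * e\<close> with \<open>m\<close> dividing \<open>a\<close> and \<open>e\<close>
  squarefree. The primes of \<open>e\<close> are at most \<open>P\<close>, so \<open>e\<close>
  divides \<open>fact P\<close>.\<close>

lemma finite_ramanujan_sum_support_smooth:
  assumes "a > 0"
  shows "finite {q \<in> smooth P. ramanujan_sum q a \<noteq> 0}"
proof (rule finite_subset)
  show "finite {q. q dvd a * fact P}" using assms by simp
  show "{q \<in> smooth P. ramanujan_sum q a \<noteq> 0} \<subseteq> {q. q dvd a * fact P}"
  proof clarify
    fix q assume q: "q \<in> smooth P" "ramanujan_sum q a \<noteq> 0"
    then have "q > 0" by (simp add: smooth_def)
    with q(2) have "(\<Sum>m | m dvd q. (if m dvd a then of_nat m else 0)
        * of_int (moebius (q div m)) :: complex) \<noteq> 0"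
      by (simp add: ramanujan_sum_eq_eratosthenes eratosthenes_def dirichlet_conv_def)
    then obtain m where m: "m dvd q" "m dvd a" "moebius (q div m) \<noteq> 0"
      by (elim sum.not_neutral_contains_not_neutral) (auto split: if_splits)
    define e where "e = q div m"
    have qe: "q = m * e" using m(1) by (simp add: e_def)
    have sf: "squarefree e" using m(3) by (auto simp: moebius_def e_def split: if_splits)
    have "e dvd fact P"
    proof (rule multiplicity_le_imp_dvd)
      show "e \<noteq> 0" using qe \<open>q > 0\<close> by auto
      fix p :: nat assume p: "prime p"
      show "multiplicity p e \<le> multiplicity p (fact P)"
      proof (cases "p dvd e")
        case True
        then have "p \<le> P" using q(1) p qe by (auto simp: smooth_def)
        then have "p dvd fact P" using p by (simp add: prime_dvd_fact_iff)
        then have "multiplicity p (fact P) \<ge> 1"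
          using p by (intro multiplicity_geI) auto
        moreover have "multiplicity p e \<le> 1"
          using sf p \<open>e \<noteq> 0\<close> by (simp add: squarefree_factorial_semiring'')
        ultimately show ?thesis by simp
      qed (simp add: not_dvd_imp_multiplicity_0)
    qed
    then show "q dvd a * fact P" using m(2) qe by (simp add: mult_dvd_mono)
  qed
qed

section \<open>Smooth parts of integers\<close>

text \<open>The least common multiple of the smooth divisors of \<open>n\<close> is again smooth: it
  divides their product, so each of its primes divides one of them.\<close>

lemma smooth_part_exists:
  assumes "n > 0"
  obtains m where "m > 0" "\<And>q. q dvd n \<and> q \<in> smooth P \<longleftrightarrow> q dvd m"
proof
  define A where "A = {q. q dvd n \<and> q \<in> smooth P}"
  have fin: "finite A" unfolding A_def using assms by simp
  have "(\<Prod>A) > 0" by (rule prod_pos) (auto simp: A_def smooth_def)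
  moreover have "Lcm A dvd \<Prod>A" by (intro Lcm_least dvd_prodI fin) (use fin in auto)
  ultimately show pos: "Lcm A > 0" by (rule dvd_pos_nat)
  have "p \<le> P" if "prime p" "p dvd Lcm A" for p
  proof -
    have "p dvd \<Prod>A" using that(2) \<open>Lcm A dvd \<Prod>A\<close> by (rule dvd_trans)
    then obtain q where "q \<in> A" "p dvd q" using prime_dvd_prod_iff[OF fin \<open>prime p\<close>, of "\<lambda>x. x"] by auto
    then show ?thesis using that by (auto simp: A_def smooth_def)
  qed
  then have "q \<in> smooth P" if "q dvd Lcm A" for q
    using dvd_pos_nat[OF pos that] dvd_trans[OF _ that] by (auto simp: smooth_def)
  moreover have "Lcm A dvd n" by (rule Lcm_least) (auto simp: A_def)
  moreover have "q dvd Lcm A" if "q dvd n" "q \<in> smooth P" for q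
    using that by (intro dvd_Lcm) (simp add: A_def)
  ultimately show "q dvd n \<and> q \<in> smooth P \<longleftrightarrow> q dvd Lcm A" for q
    using dvd_trans by blast
qed

section \<open>Convergence of the irregular series\<close>

text \<open>The primes dividing \<open>fact P\<close> are exactly those up to \<open>P\<close>. In
  this form a finite Moebius sum can detect the sifted integers.\<close>

lemma sifted_iff_coprime_fact:
  assumes "r > 0"
  shows "r \<in> sifted P \<longleftrightarrow> coprime r (fact P)"
proof -
  have "coprime r (fact P) \<longleftrightarrow> (\<forall>p. prime p \<longrightarrow> \<not> (p dvd r \<and> p dvd fact P))"
    by (metis coprime_iff_gcd_eq_1 gcd_greatest_iff not_prime_unit prime_factor_nat)
  also have "\<dots> \<longleftrightarrow> r \<in> sifted P"
    using assms by (auto simp: sifted_def prime_dvd_fact_iff not_le)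
  finally show ?thesis by simp
qed

text \<open>Inclusion-exclusion over the divisors of \<open>P!\<close> writes the series over \<open>sifted P\<close> as a finite
  combination of the series of the \<open>Win F (d * e)\<close>, so it inherits their conditional convergence.\<close>

lemma summable_Irr_terms:
  assumes Win: "\<And>q. q > 0 \<Longrightarrow> summable (Win_terms F q)" and d: "d > 0"
  shows "summable (Irr_terms F P d)"
proof -
  define g where "g n = (\<Sum>e | e dvd fact P. of_int (moebius e) * Win_terms F (d * e) n)" for n
  have "summable g"
    unfolding g_def
  proof (intro summable_sum summable_mult Win)
    fix e :: nat assume "e \<in> {e. e dvd fact P}"
    then have "e > 0" using dvd_pos_nat[of "fact P" e] by simp
    then show "d * e > 0" using d by simp
  qed
  \<comment> \<open>Passing to the subsequence \<open>d * r\<close> keeps the order and drops only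
    zero terms, so even conditional convergence survives.\<close>
  moreover have "g n = 0" if "n \<notin> range ((*) d)" for n
  proof -
    have "\<not> d * e dvd n" for e using that by (metis dvdE mult.assoc rangeI)
    then show ?thesis by (simp add: g_def Win_terms_def restrict_to_def multiples_def)
  qed
  moreover have "strict_mono ((*) d)" using d by (simp add: strict_mono_def)
  ultimately have "summable (\<lambda>r. g (d * r))"
    using summable_mono_reindex[of "(*) d" g] by simp
  then have "summable (\<lambda>r. of_nat d * g (d * r))" by (rule summable_mult)
  \<comment> \<open>The identity may fail at \<open>r = 1\<close>, which the irregular series omits;
    finitely many exceptions do not affect convergence.\<close>
  moreover have "of_nat d * g (d * r) = Irr_terms F P d r" if r: "r > 1" for r
  proof -
    let ?t = "eratosthenes F (d * r) / of_nat (d * r)"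
    have "g (d * r) = (\<Sum>e | e dvd fact P. if e dvd r then of_int (moebius e) * ?t else 0)"
      unfolding g_def
      by (rule sum.cong) (use d r in \<open>auto simp: Win_terms_def restrict_to_def multiples_def\<close>)
    also have "\<dots> = (\<Sum>e | e dvd gcd (fact P) r. of_int (moebius e) * ?t)"
      by (subst sum.inter_filter[symmetric]) auto
    also have "\<dots> = (\<Sum>e | e dvd gcd (fact P) r. of_int (moebius e)) * ?t"
      by (rule sum_distrib_right[symmetric])
    also have "\<dots> = (if coprime r (fact P) then ?t else 0)"
      using r by (subst sum_of_moebius_divisors) (auto simp: coprime_iff_gcd_eq_1 gcd.commute[of "fact P"])
    finally show ?thesis
      using d r sifted_iff_coprime_fact[of r P]
      by (auto simp: Irr_terms_def restrict_to_def)
  qed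
  then have "eventually (\<lambda>r. of_nat d * g (d * r) = Irr_terms F P d r) sequentially"
    by (auto simp: eventually_sequentially intro!: exI[of _ 2])
  ultimately show ?thesis using summable_cong by metis
qed

section \<open>Bounds by the non-smooth tail\<close>

text \<open>The two series differ only at non-smooth multiples of \<open>q\<close>. The bound is
  free of \<open>q\<close>, which gives the uniformity of the limit.\<close>

lemma norm_Win_diff_le:
  assumes "summable (Win_terms F q)" "summable (smooth_Win_terms F P q)"
    and tail: "summable (nonsmooth_tail_terms F P)"
  shows "norm (smooth_Win F P q - Win F q) \<le> suminf (nonsmooth_tail_terms F P)"
proof -
  have "smooth_Win F P q - Win F q = (\<Sum>n. smooth_Win_terms F P q n - Win_terms F q n)"
    unfolding smooth_Win_def Win_def using assms(2,1) by (rule suminf_diff)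
  also have "norm \<dots> \<le> suminf (nonsmooth_tail_terms F P)"
    by (rule norm_suminf_le[OF _ tail])
       (auto simp: smooth_Win_terms_def Win_terms_def nonsmooth_tail_terms_def restrict_to_def
          multiples_def norm_divide)
  finally show ?thesis .
qed

lemma nonsmooth_tail_terms_nonneg: "nonsmooth_tail_terms F P n \<ge> 0"
  by (simp add: nonsmooth_tail_terms_def restrict_to_def)

lemma mult_sifted_not_smooth:
  assumes "r \<in> sifted P" "r > 1" "d > 0"
  shows "d * r \<notin> smooth P"
proof -
  obtain p where "prime p" "p dvd r" using assms(2) prime_factor_nat[of r] by auto
  then have "prime p" "p dvd d * r" "p > P" using assms(1) by (auto simp: sifted_def)
  then show ?thesis unfolding smooth_def using leD by blast
qed

text \<open>Since \<open>1 / r = d / (d * r)\<close>, each term is \<open>d\<close> times a term of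
  the tail in absolute value, at the non-smooth integer \<open>d * r\<close>; distinct
  \<open>r\<close> use distinct terms.\<close>

lemma norm_Irr_le:
  assumes tail: "summable (nonsmooth_tail_terms F P)" and d: "d > 0"
  shows "norm (Irr F P d) \<le> real d * suminf (nonsmooth_tail_terms F P)"
proof -
  \<comment> \<open>Zeroing the tail off the multiples of \<open>d\<close> allows reindexing by
    \<open>r\<close> without changing the sum.\<close>
  define h where "h = restrict_to (range ((*) d)) (nonsmooth_tail_terms F P)"
  have le: "h n \<le> nonsmooth_tail_terms F P n" and nn: "h n \<ge> 0" for n
    by (auto simp: h_def restrict_to_def nonsmooth_tail_terms_nonneg)
  have h: "summable h"
    by (rule summable_comparison_test'[OF tail, of 0]) (use le nn in auto)
  have mono: "strict_mono ((*) d)" using d by (simp add: strict_mono_def)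
  have zero: "h n = 0" if "n \<notin> range ((*) d)" for n
    using that by (simp add: h_def restrict_to_def)
  have hd: "summable (\<lambda>r. h (d * r))"
    using summable_mono_reindex[OF mono, of h] zero h by simp
  have "norm (Irr F P d) \<le> (\<Sum>r. real d * h (d * r))"
    unfolding Irr_def
  proof (rule norm_suminf_le[OF _ summable_mult[OF hd]])
    fix r
    show "norm (Irr_terms F P d r) \<le> real d * h (d * r)"
    proof (cases "r \<in> sifted P \<and> r > 1")
      case True
      then show ?thesis using d mult_sifted_not_smooth[of r P d]
        by (simp add: Irr_terms_def h_def restrict_to_def nonsmooth_tail_terms_def norm_divide)
    qed (use nn in \<open>auto simp: Irr_terms_def restrict_to_def\<close>)
  qed
  also have "\<dots> = real d * (\<Sum>r. h (d * r))" by (rule suminf_mult[OF hd])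
  also have "(\<Sum>r. h (d * r)) = suminf h" using suminf_mono_reindex[OF mono, of h] zero by simp
  also have "suminf h \<le> suminf (nonsmooth_tail_terms F P)" by (rule suminf_le[OF le h tail])
  finally show ?thesis using d by simp
qed

lemma Ramanujan_terms_eq_0:
  "q \<notin> {q \<in> smooth P. ramanujan_sum q a \<noteq> 0} \<Longrightarrow> Ramanujan_terms F P a q = 0"
  by (auto simp: Ramanujan_terms_def restrict_to_def)

lemma summable_Ramanujan_terms: "a > 0 \<Longrightarrow> summable (Ramanujan_terms F P a)"
  by (rule summable_finite[OF finite_ramanujan_sum_support_smooth Ramanujan_terms_eq_0])

text \<open>Interchanging the finite sum over \<open>q\<close> with the series defining \<open>Win F q\<close>, the coefficient of
  \<open>F' n / n\<close> becomes \<open>m\<close> if the \<open>P\<close>-smooth part \<open>m\<close> of \<open>n\<close> divides \<open>a\<close>, and \<open>0\<close> otherwise. The smooth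
  \<open>n\<close> thus contribute \<open>F' n\<close> for each divisor \<open>n\<close> of \<open>a\<close>, and the other coefficients are at most \<open>a\<close>.\<close>

lemma norm_Ramanujan_series_diff_le:
  assumes Win: "\<And>q. q > 0 \<Longrightarrow> summable (Win_terms F q)"
    and tail: "summable (nonsmooth_tail_terms F P)"
    and a: "a > 0" "a \<le> P"
  shows "norm (suminf (Ramanujan_terms F P a) - F a) \<le> real a * suminf (nonsmooth_tail_terms F P)"
proof -
  define A where "A = {q \<in> smooth P. ramanujan_sum q a \<noteq> 0}"
  have finA: "finite A" unfolding A_def by (rule finite_ramanujan_sum_support_smooth[OF a(1)])
  have WA: "summable (Win_terms F q)" if "q \<in> A" for q
    using that by (intro Win) (auto simp: A_def smooth_def)
  define T where "T n = (\<Sum>q\<in>A. Win_terms F q n * ramanujan_sum q a)" for n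
  \<comment> \<open>\<open>F a\<close> as a series over \<open>n\<close>, to be compared termwise
    with \<open>T\<close>.\<close>
  define D where "D = restrict_to {n. n dvd a} (eratosthenes F)"
  have sumT: "summable T"
    unfolding T_def by (intro summable_sum summable_mult2 WA)
  have "suminf (Ramanujan_terms F P a) = (\<Sum>q\<in>A. Ramanujan_terms F P a q)"
    by (rule suminf_finite[OF finA]) (use Ramanujan_terms_eq_0 in \<open>auto simp: A_def\<close>)
  also have "\<dots> = (\<Sum>q\<in>A. \<Sum>n. Win_terms F q n * ramanujan_sum q a)"
    by (intro sum.cong refl)
       (auto simp: Ramanujan_terms_def restrict_to_def Win_def suminf_mult2[OF WA] A_def)
  also have "\<dots> = suminf T"
    unfolding T_def by (rule suminf_sum[symmetric]) (intro summable_mult2 WA)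
  finally have T: "suminf (Ramanujan_terms F P a) = suminf T" .
  have finD: "finite {n. n dvd a}" using a by simp
  have D0: "n \<notin> {n. n dvd a} \<Longrightarrow> D n = 0" for n by (simp add: D_def restrict_to_def)
  have "suminf D = (\<Sum>n | n dvd a. D n)" by (rule suminf_finite[OF finD D0])
  also have "\<dots> = (\<Sum>n | n dvd a. eratosthenes F n)" by (simp add: D_def restrict_to_def)
  also have "\<dots> = F a" by (rule sum_eratosthenes_divisors[OF a(1)])
  finally have D: "suminf D = F a" .
  have sumD: "summable D" by (rule summable_finite[OF finD D0])
  have bound: "norm (T n - D n) \<le> real a * nonsmooth_tail_terms F P n" for n
  proof (cases "n = 0")
    case True
    then show ?thesis using a
      by (simp add: T_def D_def Win_terms_def restrict_to_def multiples_def nonsmooth_tail_terms_nonneg)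
  next
    case False
    then have n: "n > 0" by simp
    obtain m where m: "m > 0" "\<And>q. q dvd n \<and> q \<in> smooth P \<longleftrightarrow> q dvd m"
      using smooth_part_exists[OF n] by blast
    have "T n = (\<Sum>q\<in>A. if q dvd n then eratosthenes F n / of_nat n * ramanujan_sum q a else 0)"
      unfolding T_def
      by (rule sum.cong) (use n in \<open>auto simp: Win_terms_def restrict_to_def multiples_def\<close>)
    also have "\<dots> = (\<Sum>q | q \<in> A \<and> q dvd n. eratosthenes F n / of_nat n * ramanujan_sum q a)"
      by (rule sum.inter_filter[symmetric, OF finA])
    \<comment> \<open>The smooth divisors of \<open>n\<close> are the divisors of \<open>m\<close>;
      those outside \<open>A\<close> have Ramanujan sum 0.\<close>
    also have "\<dots> = (\<Sum>q | q dvd m. eratosthenes F n / of_nat n * ramanujan_sum q a)"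
      by (rule sum.mono_neutral_left) (use m in \<open>auto simp: A_def\<close>)
    also have "\<dots> = eratosthenes F n / of_nat n
        * (\<Sum>q | q dvd m. eratosthenes (\<lambda>m. if m dvd a then of_nat m else 0) q)"
      unfolding sum_distrib_left
      by (intro sum.cong refl arg_cong2[where f = "(*)"] ramanujan_sum_eq_eratosthenes)
         (use dvd_pos_nat[OF m(1)] in auto)
    also have "\<dots> = eratosthenes F n / of_nat n * (if m dvd a then of_nat m else 0)"
      by (simp add: sum_eratosthenes_divisors[OF m(1)])
    finally have Tn: "T n = eratosthenes F n / of_nat n * (if m dvd a then of_nat m else 0)" .
    show ?thesis
    proof (cases "n \<in> smooth P")
      case True
      then have "n dvd m" "m dvd n" using m(2)[of n] m(2)[of m] by auto
      then have "m = n" by (simp add: dvd_antisym)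
      then show ?thesis using n a Tn
        by (auto simp: D_def restrict_to_def nonsmooth_tail_terms_nonneg)
    next
      case False
      \<comment> \<open>As \<open>a \<le> P\<close>, every divisor of \<open>a\<close> is
        smooth.\<close>
      have "\<not> n dvd a"
      proof
        assume "n dvd a"
        then have "p \<le> P" if "p dvd n" for p
          using that a by (meson dvd_imp_le dvd_trans le_trans)
        then show False using False n by (auto simp: smooth_def)
      qed
      then have "D n = 0" by (simp add: D_def restrict_to_def)
      moreover have "norm (T n) = cmod (eratosthenes F n) / real n * (if m dvd a then real m else 0)"
        by (simp add: Tn norm_mult norm_divide)
      moreover have "\<dots> \<le> cmod (eratosthenes F n) / real n * real a"
        using a dvd_imp_le[of m a] by (intro mult_left_mono) auto
      ultimately show ?thesis using False n
        by (simp add: nonsmooth_tail_terms_def restrict_to_def mult.commute)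
    qed
  qed
  have "suminf (Ramanujan_terms F P a) - F a = (\<Sum>n. T n - D n)"
    unfolding T D[symmetric] by (rule suminf_diff[OF sumT sumD])
  also have "norm \<dots> \<le> (\<Sum>n. real a * nonsmooth_tail_terms F P n)"
    by (rule norm_suminf_le[OF bound summable_mult[OF tail]])
  also have "\<dots> = real a * suminf (nonsmooth_tail_terms F P)" by (rule suminf_mult[OF tail])
  finally show ?thesis .
qed

section \<open>Limits along the primes\<close>

theorem theorem1:
  fixes F :: "nat \<Rightarrow> complex"
  assumes Win_exists: "\<And>q. q > 0 \<Longrightarrow> summable (Win_terms F q)"
    and smooth_Win_exists: "\<And>P q. prime P \<Longrightarrow> q > 0 \<Longrightarrow> summable (smooth_Win_terms F P q)"
    and WSA: "Wintner_Smooth_Assumption F"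
  shows "uniform_limit {q. q > 0} (\<lambda>P q. smooth_Win F P q) (\<lambda>q. Win F q) primes_at_top
    \<and> (\<forall>d>0. (\<forall>P. prime P \<longrightarrow> summable (Irr_terms F P d))
          \<and> ((\<lambda>P. Irr F P d) \<longlongrightarrow> 0) primes_at_top)
    \<and> (\<forall>a>0. (\<forall>P. prime P \<longrightarrow> summable (Ramanujan_terms F P a))
          \<and> ((\<lambda>P. suminf (Ramanujan_terms F P a)) \<longlongrightarrow> F a) primes_at_top)"
proof -
  obtain P\<^sub>F where P\<^sub>F: "\<And>P. prime P \<Longrightarrow> P > P\<^sub>F \<Longrightarrow> summable (nonsmooth_tail_terms F P)"
    using WSA by (auto simp: Wintner_Smooth_Assumption_def)
  have lim: "((\<lambda>P. suminf (nonsmooth_tail_terms F P)) \<longlongrightarrow> 0) primes_at_top"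
    using WSA by (simp add: Wintner_Smooth_Assumption_def)
  \<comment> \<open>The threshold gives both \<open>P > P\<^sub>F\<close>, for convergence of the
    tail, and \<open>P \<ge> a\<close>, for the bound on the Ramanujan series.\<close>
  have tail: "eventually (\<lambda>P. prime P \<and> P \<ge> a \<and> summable (nonsmooth_tail_terms F P)) primes_at_top" for a
    unfolding eventually_primes_at_top
    by (intro exI[of _ "max a (Suc P\<^sub>F)"]) (auto intro: P\<^sub>F)
  have lim_mult: "((\<lambda>P. c * suminf (nonsmooth_tail_terms F P)) \<longlongrightarrow> 0) primes_at_top" for c
    using tendsto_mult_right_zero[OF lim] .
  show ?thesis
  proof (intro conjI allI impI)
    show "uniform_limit {q. q > 0} (\<lambda>P q. smooth_Win F P q) (\<lambda>q. Win F q) primes_at_top"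
    proof (rule uniform_limitI)
      fix e :: real assume "e > 0"
      then have "eventually (\<lambda>P. suminf (nonsmooth_tail_terms F P) < e) primes_at_top"
        by (rule order_tendstoD(2)[OF lim])
      with tail[of 0]
      show "\<forall>\<^sub>F P in primes_at_top. \<forall>q\<in>{q. q > 0}. dist (smooth_Win F P q) (Win F q) < e"
      proof eventually_elim
        case (elim P)
        then show ?case
          using norm_Win_diff_le[OF Win_exists smooth_Win_exists, of _ P]
          by (auto simp: dist_norm intro: le_less_trans)
      qed
    qed
  next
    fix d P :: nat assume "d > 0"
    then show "summable (Irr_terms F P d)" by (intro summable_Irr_terms Win_exists)
  next
    fix d :: nat assume "d > 0"
    then have "eventually (\<lambda>P. norm (Irr F P d) \<le> real d * suminf (nonsmooth_tail_terms F P)) primes_at_top"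
      using tail[of 0] by (auto elim!: eventually_mono intro: norm_Irr_le)
    then show "((\<lambda>P. Irr F P d) \<longlongrightarrow> 0) primes_at_top"
      using lim_mult by (rule Lim_null_comparison)
  next
    fix a P :: nat assume "a > 0"
    then show "summable (Ramanujan_terms F P a)" by (rule summable_Ramanujan_terms)
  next
    fix a :: nat assume "a > 0"
    then have "eventually (\<lambda>P. norm (suminf (Ramanujan_terms F P a) - F a)
        \<le> real a * suminf (nonsmooth_tail_terms F P)) primes_at_top"
      using tail[of a] by (auto elim!: eventually_mono intro: norm_Ramanujan_series_diff_le Win_exists)
    then have "((\<lambda>P. suminf (Ramanujan_terms F P a) - F a) \<longlongrightarrow> 0) primes_at_top"
      using lim_mult by (rule Lim_null_comparison)
    then show "((\<lambda>P. suminf (Ramanujan_terms F P a)) \<longlongrightarrow> F a) primes_at_top"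
      by (simp add: LIM_zero_iff)
  qed
qed

end
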